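(* For every integer $n\ge 1$, $$|\mathcal{S}_n(12;\,3\to 3)| = d_n + \sum_{m=1}^{n}\sum_{k=0}^{n-m}\binom{n-m}{k}\binom{m+k-1}{n-m}\, d_k,$$ where $d_j$ denotes the $j$-th derangement number.
   Context: $[n]=\{1,\dots,n\}$, and $\mathcal{S}_n$ is the set of permutations $\pi=\pi_1\pi_2\cdots\pi_n$ of $[n]$ in one-line notation. The permutation $\hat\pi$: for $\pi\in\mathcal{S}_n$, $\hat\pi\in\mathcal{S}_n$ is the permutation whose cycle form is obtained from the word $\pi_1\cdots\pi_n$ by inserting a left parenthesis before each left-to-right maximum (an entry larger than all entries to its left) and a right parenthesis immediately before the next left-to-right maximum, or at the end of the word. A cycle $(c_1,c_2,\dots,c_s)$ means $c_1\mapsto c_2\mapsto\cdots\mapsto c_s\mapsto c_1$. Example: if $\pi=2537164$ then $\hat\pi=(2)(53)(7164)$. Arrow patterns: an arrow pattern of size $k$ is a pair $(\nu;H)$ where $\nu=\nu_1\cdots\nu_m$ is a word of distinct positive integers, $H$ is a collection of arrows $b_i\to c_i$, and the set of all integers appearing in $\nu$ or $H$ is $[k]$. A permutation $\pi\in\mathcal{S}_n$ contains $(\nu;H)$ if there are a set $X=\{x_1<x_2<\cdots<x_k\}\subseteq[n]$ and indices $t_1<\cdots<t_m$ such that $\pi_{t_1}\pi_{t_2}\cdots\pi_{t_m}=x_{\nu_1}x_{\nu_2}\cdots x_{\nu_m}$ and $\hat\pi(x_{b_i})=x_{c_i}$ for every arrow $b_i\to c_i$ in $H$. Otherwise $\pi$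 avoids $(\nu;H)$. $\mathcal{S}_n(\nu;H)$ is the set of permutations in $\mathcal{S}_n$ avoiding $(\nu;H)$. The derangement number $d_j$ is the number of permutations of $[j]$ without fixed points ($d_0=1$, $d_1=0$). Binomial coefficients $\binom{a}{b}$ with $0\le a<b$ are $0$. *)

theory Defs
  imports "HOL-Combinatorics.Combinatorics"
begin

text \<open>
  A permutation of \<open>{1..n}\<close> in one-line notation is a word \<open>w \<in> permutations_of_set {1..n}\<close>.
  List positions start at \<open>0\<close>, so the entry written \<open>\<pi>\<^sub>i\<close> in the literature is \<open>w ! (i - 1)\<close>.
\<close>

definition lr_max :: "nat list \<Rightarrow> nat \<Rightarrow> bool" where
  "lr_max w i \<longleftrightarrow> i < length w \<and> (\<forall>j<i. w ! j < w ! i)"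

definition lr_max_positions :: "nat list \<Rightarrow> nat list" where
  "lr_max_positions w = filter (lr_max w) [0..<length w]"

text \<open>
  The factors of \<open>w\<close> obtained by opening a parenthesis before each left-to-right maximum
  and closing it immediately before the next one, or at the end of the word.
\<close>

definition cycle_words :: "nat list \<Rightarrow> nat list list" where
  "cycle_words w =
     map2 (\<lambda>i j. drop i (take j w))
       (lr_max_positions w) (tl (lr_max_positions w) @ [length w])"

text \<open>
  The permutation \<open>\<pi>\<close>-hat, as a function on \<open>nat\<close> that is the identity off the entries of the word.
  Here \<open>cycle_of_list [c\<^sub>1, \<dots>, c\<^sub>s]\<close> maps \<open>c\<^sub>1\<close> to \<open>c\<^sub>2\<close>, \dots, \<open>c\<^sub>s\<close> to \<open>c\<^sub>1\<close>, and since the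
  factors of the word are disjoint the order of composition is irrelevant.
\<close>

definition hat :: "nat list \<Rightarrow> nat \<Rightarrow> nat" where
  "hat w = foldr (\<circ>) (map cycle_of_list (cycle_words w)) id"

lemma hat_example:
  "cycle_words [2,5,3,7,1,6,4] = [[2], [5,3], [7,1,6,4]]"
  "map (hat [2,5,3,7,1,6,4]) [1,2,3,4,5,6,7] = [6,2,5,7,3,4,1]"
  by (simp_all add: hat_def cycle_words_def lr_max_positions_def lr_max_def upt_rec
      All_less_Suc numeral_eq_Suc transpose_def)

text \<open>An arrow pattern \<open>(\<nu>; H)\<close> is a pair of a word and a set of arrows, \<open>(b, c)\<close> standing for \<open>b \<rightarrow> c\<close>.\<close>

type_synonym arrow_pattern = "nat list \<times> (nat \<times> nat) set"

fun pattern_support :: "arrow_pattern \<Rightarrow> nat set" where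
  "pattern_support (\<nu>, H) = set \<nu> \<union> fst ` H \<union> snd ` H"

definition is_arrow_pattern :: "nat \<Rightarrow> arrow_pattern \<Rightarrow> bool" where
  "is_arrow_pattern k P \<longleftrightarrow> distinct (fst P) \<and> pattern_support P = {1..k}"

text \<open>
  The set \<open>X = {x\<^sub>1 < \<dots> < x\<^sub>k}\<close> is given by its increasing enumeration \<open>x\<close>, and
  \<open>t\<close> enumerates (zero-based) positions of the word. The size \<open>k\<close> is read off as the
  cardinality of the support, which is right for any \<open>P\<close> with \<open>is_arrow_pattern k P\<close>.
\<close>

fun contains_arrow_pattern :: "nat list \<Rightarrow> arrow_pattern \<Rightarrow> bool" where
  "contains_arrow_pattern w (\<nu>, H) \<longleftrightarrow>
     (\<exists>(x :: nat \<Rightarrow> nat) (t :: nat \<Rightarrow> nat).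
        strict_mono_on {1..card (pattern_support (\<nu>, H))} x \<and>
        x ` {1..card (pattern_support (\<nu>, H))} \<subseteq> {1..length w} \<and>
        strict_mono_on {..<length \<nu>} t \<and>
        t ` {..<length \<nu>} \<subseteq> {..<length w} \<and>
        (\<forall>i<length \<nu>. w ! t i = x (\<nu> ! i)) \<and>
        (\<forall>(b, c)\<in>H. hat w (x b) = x c))"

definition avoiders :: "nat \<Rightarrow> arrow_pattern \<Rightarrow> nat list set" where
  "avoiders n P = {w \<in> permutations_of_set {1..n}. \<not> contains_arrow_pattern w P}"

lemma is_arrow_pattern_12_33: "is_arrow_pattern 3 ([1, 2], {(3, 3)})"
  by (auto simp: is_arrow_pattern_def)

definition derangement_number :: "nat \<Rightarrow> nat" where
  "derangement_number j = card {p. p permutes {1..j} \<and> (\<forall>i\<in>{1..j}. p i \<noteq> i)}"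

end

theory Submission
  imports Defs
begin

text \<open>
  A letter \<open>v\<close> is fixed by \<open>hat w\<close> exactly if it is a left-to-right maximum of \<open>w\<close> that ends the word
  or is immediately followed by a larger letter. Such a letter can be deleted from \<open>w\<close>, and put back
  just before the first larger letter, without affecting the other fixed letters. So the
  words on \<open>A\<close> with fixed set \<open>F\<close> are counted by the words on \<open>A - F\<close> with no fixed letter, whose
  numbers satisfy the same recurrence \<open>\<Sum>\<^sub>B\<^sub>\<subseteq>\<^sub>A d(B) = |A|!\<close> as the numbers of derangements.

  A word with largest fixed letter \<open>m\<close> avoids the pattern iff the letters below \<open>m\<close> are decreasing.
  After deletion of \<open>m\<close>, it is a shuffle of \<open>m-1, \<dots>, 1\<close> with a word \<open>\<sigma>\<close> on \<open>{m+1..n}\<close> in which every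
  fixed letter of \<open>\<sigma>\<close> is followed by a letter below \<open>m\<close>. If \<open>\<sigma>\<close> has \<open>n-m-k\<close> fixed letters,
  there are \<open>(m+k-1) choose (n-m)\<close> such shuffles.
\<close>

text \<open>Letters rather than positions are collected, over an arbitrary linear order, because the
  counting deletes letters and passes to words on other alphabets.\<close>

definition isolated_maxima :: "'a::linorder list \<Rightarrow> 'a set" where
  "isolated_maxima w =
     {v. \<exists>u r. w = u @ v # r \<and> (\<forall>x\<in>set u. x < v) \<and> (r = [] \<or> v < hd r)}"

lemma isolated_maxima_subset: "isolated_maxima w \<subseteq> set w"
  by (auto simp: isolated_maxima_def)

text \<open>Distinctness leaves only one way to split the word at \<open>v\<close>, so the
  existential quantifiers of the definition disappear.\<close>

lemma isolated_maxima_iff: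
  assumes "distinct (u @ v # r)"
  shows "v \<in> isolated_maxima (u @ v # r) \<longleftrightarrow> (\<forall>x\<in>set u. x < v) \<and> (r = [] \<or> v < hd r)"
proof
  assume "v \<in> isolated_maxima (u @ v # r)"
  then obtain u' r' where *: "u @ v # r = u' @ v # r'" "\<forall>x\<in>set u'. x < v" "r' = [] \<or> v < hd r'"
    by (auto simp: isolated_maxima_def)
  have "u = u' \<and> r = r'"
    using *(1) assms by (subst (asm) append_Cons_eq_iff) auto
  with * show "(\<forall>x\<in>set u. x < v) \<and> (r = [] \<or> v < hd r)" by simp
qed (auto simp: isolated_maxima_def)

subsection \<open>Fixed points of the hat permutation\<close>

text \<open>Splitting at the largest letter \<open>m\<close> turns the positional definition of
  \<open>hat\<close> into a recursion: entries of \<open>u\<close> are compared only within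
  \<open>u\<close>, and nothing after \<open>m\<close> exceeds it.\<close>

lemma lr_max_positions_append:
  assumes "\<forall>x\<in>set u. x < m" "\<forall>x\<in>set v. x < m"
  shows "lr_max_positions (u @ m # v) = lr_max_positions u @ [length u]"
proof -
  have split: "[0..<length (u @ m # v)] =
      [0..<length u] @ length u # [Suc (length u)..<length (u @ m # v)]"
    using upt_add_eq_append[of 0 "length u" "Suc (length v)"]
    by (simp add: upt_conv_Cons del: upt_Suc)
  have 1: "filter (lr_max (u @ m # v)) [0..<length u] = filter (lr_max u) [0..<length u]"
    by (rule filter_cong) (auto simp: lr_max_def nth_append)
  have 2: "lr_max (u @ m # v) (length u)"
    using assms by (auto simp: lr_max_def nth_append)
  have 3: "\<not> lr_max (u @ m # v) i" if "i \<in> {Suc (length u)..<length (u @ m # v)}" for i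
  proof
    assume "lr_max (u @ m # v) i"
    then have "(u @ m # v) ! length u < (u @ m # v) ! i"
      using that unfolding lr_max_def by (metis Suc_le_lessD atLeastLessThan_iff)
    moreover have "(u @ m # v) ! i \<in> set v"
      using that by (auto simp: nth_append nth_Cons split: nat.splits)
    ultimately show False using assms(2) by fastforce
  qed
  have "filter (lr_max (u @ m # v)) [Suc (length u)..<length (u @ m # v)] = []"
    using 3 by (subst filter_empty_conv) auto
  then show ?thesis
    unfolding lr_max_positions_def split using 1 2 by simp
qed

lemma lr_max_positions_le: "i \<in> set (lr_max_positions u) \<Longrightarrow> i < length u"
  by (auto simp: lr_max_positions_def)

lemma lr_max_positions_eq_Nil: "lr_max_positions u = [] \<longleftrightarrow> u = []"
  by (cases u) (auto simp: lr_max_positions_def lr_max_def upt_conv_Cons simp del: upt_Suc)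

text \<open>The last cycle opens at the largest letter. The index \<open>length u\<close>, which
  closes the last cycle of \<open>u\<close> at the end of the word, is now the position of
  \<open>m\<close>, so the earlier cycles are unchanged.\<close>

lemma cycle_words_append:
  assumes "\<forall>x\<in>set u. x < m" "\<forall>x\<in>set v. x < m"
  shows "cycle_words (u @ m # v) = cycle_words u @ [m # v]"
proof (cases "u = []")
  case True
  then show ?thesis
    using lr_max_positions_append[OF assms] by (simp add: cycle_words_def lr_max_positions_def)
next
  case False
  let ?P = "lr_max_positions u"
  from False have P: "?P \<noteq> []" by (simp add: lr_max_positions_eq_Nil)
  then have len: "length ?P = length (tl ?P @ [length u])" by simp
  have "cycle_words (u @ m # v) =
      map2 (\<lambda>i j. drop i (take j (u @ m # v))) ?P (tl ?P @ [length u]) @ [m # v]"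
    unfolding cycle_words_def lr_max_positions_append[OF assms]
    using P len zip_append[OF len, of "[length u]" "[length (u @ m # v)]"]
    by (simp del: zip_append take_append drop_append) simp
  also have "map2 (\<lambda>i j. drop i (take j (u @ m # v))) ?P (tl ?P @ [length u]) = cycle_words u"
    unfolding cycle_words_def
  proof (rule map_cong[OF refl], clarify)
    fix i j assume "(i, j) \<in> set (zip ?P (tl ?P @ [length u]))"
    then have "j \<in> set (tl ?P @ [length u])" by (rule set_zip_rightD)
    then have "j \<le> length u"
      using lr_max_positions_le[of j u] list.set_sel(2)[OF P] by fastforce
    then show "drop i (take j (u @ m # v)) = drop i (take j u)" by simp
  qed
  finally show ?thesis .
qed

lemma split_at_Max:
  fixes w :: "'a::linorder list"
  assumes "w \<noteq> []" "distinct w"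
  obtains u m v where "w = u @ m # v" "\<forall>x\<in>set u. x < m" "\<forall>x\<in>set v. x < m"
proof -
  have "Max (set w) \<in> set w" using assms by simp
  then obtain u v where w: "w = u @ Max (set w) # v" by (auto simp: in_set_conv_decomp)
  have "x < Max (set w)" if "x \<in> set w" "x \<noteq> Max (set w)" for x
    using that by (simp add: order_less_le)
  moreover have "Max (set w) \<notin> set u" "Max (set w) \<notin> set v"
    using assms(2) w by (metis distinct.simps(2) distinct_append disjoint_iff list.set_intros(1))+
  moreover have "set u \<union> set v \<subseteq> set w"
    using w by (metis Un_mono order_refl set_append set_subset_Cons)
  ultimately show ?thesis using that[OF w] by (metis UnCI subsetD)
qed

lemma hat_append:
  assumes "\<forall>x\<in>set u. x < m" "\<forall>x\<in>set v. x < m"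
  shows "hat (u @ m # v) = hat u \<circ> cycle_of_list (m # v)"
proof -
  have foldr: "foldr (\<circ>) fs g = foldr (\<circ>) fs id \<circ> g" for fs and g :: "nat \<Rightarrow> nat"
    by (induction fs) (auto simp: o_assoc)
  show ?thesis
    unfolding hat_def cycle_words_append[OF assms] by (simp add: foldr[of _ "cycle_of_list _"])
qed

lemma hat_outside: "distinct w \<Longrightarrow> x \<notin> set w \<Longrightarrow> hat w x = x"
proof (induction "length w" arbitrary: w rule: less_induct)
  case less
  show ?case
  proof (cases "w = []")
    case False
    obtain u m v where *: "w = u @ m # v" "\<forall>x\<in>set u. x < m" "\<forall>x\<in>set v. x < m"
      using split_at_Max[OF False less.prems(1)] by blast
    have "hat u x = x" using less.hyps[of u] less.prems * by auto
    moreover have "cycle_of_list (m # v) x = x"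
      using less.prems * by (intro id_outside_supp) auto
    ultimately show ?thesis using hat_append[OF *(2,3)] *(1) by simp
  qed (simp add: hat_def cycle_words_def lr_max_positions_def)
qed

text \<open>A rotation puts \<open>x\<close> in front without changing the cycle; its image is then
  the second letter, which differs from \<open>x\<close> unless the cycle has length one.\<close>

lemma cycle_of_list_fixed_iff:
  assumes "distinct cs" "x \<in> set cs"
  shows "cycle_of_list cs x = x \<longleftrightarrow> cs = [x]"
proof
  assume fx: "cycle_of_list cs x = x"
  obtain u r where cs: "cs = u @ x # r" using assms(2) by (auto simp: in_set_conv_decomp)
  have *: "cycle_of_list cs = cycle_of_list (x # r @ u)"
    using cycle_of_list_rotate_independent[OF assms(1), of "length u"] cs
    by (simp add: rotate_append)
  show "cs = [x]"
  proof (cases "r @ u")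
    case Nil then show ?thesis using cs by simp
  next
    case (Cons y ys)
    then have "y \<noteq> x" using assms(1) cs
      by (metis Un_iff distinct.simps(2) distinct_append disjoint_iff list.set_intros(1) set_append)
    moreover have "x \<notin> set (y # ys)" using assms(1) cs unfolding Cons[symmetric] by auto
    \<comment> \<open>The cycle unfolds to the transposition of \<open>x\<close> and
      \<open>y\<close> applied after the cycle on \<open>y # ys\<close>, and the latter fixes
      \<open>x\<close>.\<close>
    then have "cycle_of_list (x # y # ys) x = y"
      using id_outside_supp[of x "y # ys"] by simp
    ultimately show ?thesis using fx * Cons by simp
  qed
qed (use assms in auto)

text \<open>Induction splits off the last cycle \<open>m # v\<close>. It does not move the letters
  of \<open>u\<close>, while a letter inside it is fixed only if it is the whole cycle.\<close>

lemma hat_fixed_iff: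
  assumes "distinct w" "x \<in> set w"
  shows "hat w x = x \<longleftrightarrow> x \<in> isolated_maxima w"
  using assms
proof (induction "length w" arbitrary: w rule: less_induct)
  case less
  then have "w \<noteq> []" by auto
  then obtain u m v where w: "w = u @ m # v" "\<forall>x\<in>set u. x < m" "\<forall>x\<in>set v. x < m"
    using split_at_Max[OF _ less.prems(1)] by blast
  have d: "distinct u" "distinct (m # v)" "set u \<inter> set (m # v) = {}" using less.prems w by auto
  have hat: "hat w = hat u \<circ> cycle_of_list (m # v)" using hat_append[OF w(2,3)] w(1) by simp
  show ?case
  proof (cases "x \<in> set u")
    case True
    then have "cycle_of_list (m # v) x = x" using d by (intro id_outside_supp) auto
    then have "hat w x = x \<longleftrightarrow> x \<in> isolated_maxima u"
      using hat less.hyps[of u] w(1) d True by simp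
    also obtain a b where u: "u = a @ x # b" using True by (auto simp: in_set_conv_decomp)
    \<comment> \<open>If \<open>x\<close> ends \<open>u\<close>, its successor in \<open>w\<close>
      is the larger letter \<open>m\<close>, so \<open>x\<close> qualifies in both words.\<close>
    have "x \<in> isolated_maxima u \<longleftrightarrow> x \<in> isolated_maxima w"
      using isolated_maxima_iff[of a x b] isolated_maxima_iff[of a x "b @ m # v"] d(1)
        less.prems(1) w(1,2) u by (auto simp: hd_append)
    finally show ?thesis .
  next
    case False
    then have x: "x \<in> set (m # v)" using less.prems w by simp
    have "cycle_of_list (m # v) x \<in> set (m # v)"
      using x permutes_in_image[OF cycle_permutes] by metis
    then have "cycle_of_list (m # v) x \<notin> set u" using d by blast
    then have "hat w x = cycle_of_list (m # v) x" using hat hat_outside[OF d(1)] by simp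
    then have 1: "hat w x = x \<longleftrightarrow> m # v = [x]" using cycle_of_list_fixed_iff[OF d(2) x] by simp
    show ?thesis
    proof (cases "x = m")
      case True
      then show ?thesis
        using 1 w isolated_maxima_iff[of u m v] less.prems(1) by (cases v) auto
    next
      case False
      with x obtain a b where v: "v = a @ x # b" by (auto simp: in_set_conv_decomp)
      \<comment> \<open>The larger letter \<open>m\<close> precedes \<open>x\<close>, so
        \<open>x\<close> is no left-to-right maximum.\<close>
      have "x < m" using v w by auto
      then show ?thesis
        using 1 False w(1) v isolated_maxima_iff[of "u @ m # a" x b] less.prems(1) by auto
    qed
  qed
qed

subsection \<open>Inserting an isolated maximum\<close>

text \<open>For \<open>v\<close> not in \<open>w\<close> this is the only place where
  \<open>v\<close> becomes an isolated maximum: all earlier letters must be smaller and the next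
  one, if any, larger.\<close>

definition insert_max :: "'a::linorder \<Rightarrow> 'a list \<Rightarrow> 'a list" where
  "insert_max v w = takeWhile (\<lambda>x. x < v) w @ v # dropWhile (\<lambda>x. x < v) w"

lemma mset_insert_max: "mset (insert_max v w) = add_mset v (mset w)"
  unfolding insert_max_def
  by (metis mset_append mset.simps(2) takeWhile_dropWhile_id union_mset_add_mset_right)

lemma filter_insert_max: "\<not> P v \<Longrightarrow> filter P (insert_max v w) = filter P w"
  unfolding insert_max_def
  by (metis filter.simps(2) filter_append takeWhile_dropWhile_id)

lemma filter_neq_insert_max: "v \<notin> set w \<Longrightarrow> filter (\<lambda>x. x \<noteq> v) (insert_max v w) = w"
  by (subst filter_insert_max) (auto simp: filter_id_conv)

lemma insert_max_filter_neq:
  assumes "distinct w" "v \<in> isolated_maxima w"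
  shows "insert_max v (filter (\<lambda>x. x \<noteq> v) w) = w"
proof -
  obtain u r where w: "w = u @ v # r" "\<forall>x\<in>set u. x < v" "r = [] \<or> v < hd r"
    using assms(2) by (auto simp: isolated_maxima_def)
  have "filter (\<lambda>x. x \<noteq> v) w = u @ r"
    using assms(1) w(1) by (auto intro!: arg_cong2[where f = append] simp: filter_id_conv)
  moreover have "takeWhile (\<lambda>x. x < v) r = []" "dropWhile (\<lambda>x. x < v) r = r"
    using w(3) by (cases r; auto)+
  ultimately show ?thesis
    using w by (simp add: insert_max_def takeWhile_append dropWhile_append)
qed

text \<open>A letter of \<open>a\<close> directly before \<open>v\<close> gains a larger successor,
  and before the insertion it had the larger successor \<open>hd b\<close> or none. A letter of
  \<open>b\<close> exceeding all letters of \<open>b\<close> before it is at least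
  \<open>hd b\<close>, hence above \<open>v\<close>, so the extra predecessor \<open>v\<close> is
  harmless.\<close>

lemma isolated_maxima_insert_max:
  assumes "distinct w" "v \<notin> set w"
  shows "isolated_maxima (insert_max v w) = insert v (isolated_maxima w)"
proof -
  define a b where "a = takeWhile (\<lambda>x. x < v) w" and "b = dropWhile (\<lambda>x. x < v) w"
  have w: "w = a @ b" by (simp add: a_def b_def)
  have ins: "insert_max v w = a @ v # b" by (simp add: a_def b_def insert_max_def)
  have a: "\<forall>x\<in>set a. x < v" by (auto simp: a_def dest: set_takeWhileD)
  have b: "b = [] \<or> v < hd b"
    using assms(2) hd_dropWhile[of "\<lambda>x. x < v" w] w
    by (metis b_def hd_in_set in_set_conv_decomp linorder_neqE set_dropWhileD)
  have dist: "distinct (a @ v # b)" using assms w by auto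
  have main: "x \<in> isolated_maxima (a @ v # b) \<longleftrightarrow> x \<in> isolated_maxima (a @ b)"
    if x: "x \<in> set a \<union> set b" for x
  proof (cases "x \<in> set a")
    case True
    then obtain c d where "a = c @ x # d" by (auto simp: in_set_conv_decomp)
    then show ?thesis
      using a b dist isolated_maxima_iff[of c x "d @ v # b"] isolated_maxima_iff[of c x "d @ b"]
      by (auto simp: hd_append)
  next
    case False
    with x obtain c d where b': "b = c @ x # d" by (auto simp: in_set_conv_decomp)
    have "v < x" if "\<forall>y\<in>set c. y < x"
      using b b' that by (cases c) auto
    then show ?thesis
      using b' dist isolated_maxima_iff[of "a @ v # c" x d] isolated_maxima_iff[of "a @ c" x d]
      by auto
  qed
  have "v \<in> isolated_maxima (a @ v # b)" using a b by (auto simp: isolated_maxima_def)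
  then show ?thesis
    unfolding ins using main w assms(2) isolated_maxima_subset[of "a @ v # b"]
      isolated_maxima_subset[of w] by auto
qed

lemma permutations_of_set_insert_max:
  assumes "w \<in> permutations_of_set (A - {v})" "v \<in> A"
  shows "insert_max v w \<in> permutations_of_set A"
proof -
  have "mset_set A = add_mset v (mset_set (A - {v}))" if "finite A"
    using that assms(2) by (rule mset_set.remove)
  moreover have "set (insert_max v w) = insert v (set w)"
    using mset_insert_max[of v w] by (metis set_mset_add_mset_insert set_mset_mset)
  moreover have "distinct (insert_max v w)"
    using assms mset_insert_max[of v w] distinct_count_atmost_1
    by (metis Diff_iff distinct.simps(2) mset.simps(2) mset_eq_imp_distinct_iff
        permutations_of_setD singletonI)
  ultimately show ?thesis using assms by (auto simp: permutations_of_set_def)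
qed

text \<open>The predicate \<open>P\<close> leaves room for two uses: prescribing the whole set of
  isolated maxima, and imposing the conditions of \<open>max_isolated_words\<close>.\<close>

lemma bij_betw_insert_max:
  assumes "v \<in> A"
  shows "bij_betw (insert_max v) {w \<in> permutations_of_set (A - {v}). P (insert_max v w)}
    {w \<in> permutations_of_set A. v \<in> isolated_maxima w \<and> P w}"
proof (rule bij_betw_byWitness[where f' = "filter (\<lambda>x. x \<noteq> v)"])
  show "\<forall>w\<in>{w \<in> permutations_of_set (A - {v}). P (insert_max v w)}.
      filter (\<lambda>x. x \<noteq> v) (insert_max v w) = w"
    by (auto simp: permutations_of_set_def filter_neq_insert_max)
  show "\<forall>w\<in>{w \<in> permutations_of_set A. v \<in> isolated_maxima w \<and> P w}.
      insert_max v (filter (\<lambda>x. x \<noteq> v) w) = w"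
    by (auto simp: permutations_of_set_def insert_max_filter_neq)
  show "insert_max v ` {w \<in> permutations_of_set (A - {v}). P (insert_max v w)}
      \<subseteq> {w \<in> permutations_of_set A. v \<in> isolated_maxima w \<and> P w}"
  proof clarify
    fix w assume w: "w \<in> permutations_of_set (A - {v})" and P: "P (insert_max v w)"
    have "distinct w" "v \<notin> set w" using w by (auto dest: permutations_of_setD)
    then have "v \<in> isolated_maxima (insert_max v w)" by (simp add: isolated_maxima_insert_max)
    then show "insert_max v w \<in> permutations_of_set A \<and>
        v \<in> isolated_maxima (insert_max v w) \<and> P (insert_max v w)"
      using permutations_of_set_insert_max[OF w assms] P by blast
  qed
  show "filter (\<lambda>x. x \<noteq> v) ` {w \<in> permutations_of_set A. v \<in> isolated_maxima w \<and> P w}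
      \<subseteq> {w \<in> permutations_of_set (A - {v}). P (insert_max v w)}"
  proof clarify
    fix w assume w: "w \<in> permutations_of_set A" and v: "v \<in> isolated_maxima w" and P: "P w"
    have "filter (\<lambda>x. x \<noteq> v) w \<in> permutations_of_set (A - {v})"
      using w by (auto simp: permutations_of_set_def)
    then show "filter (\<lambda>x. x \<noteq> v) w \<in> permutations_of_set (A - {v}) \<and>
        P (insert_max v (filter (\<lambda>x. x \<noteq> v) w))"
      using insert_max_filter_neq[OF permutations_of_setD(2)[OF w] v] P by simp
  qed
qed

subsection \<open>Words with prescribed isolated maxima\<close>

text \<open>The letters of \<open>F\<close> are deleted one at a time; each deletion is a bijection
  that leaves the other isolated maxima alone. The alphabet shrinks with each step, so the induction
  generalizes over \<open>A\<close>.\<close>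

lemma card_isolated_maxima_eq:
  assumes "finite A" "F \<subseteq> A"
  shows "card {w \<in> permutations_of_set A. isolated_maxima w = F} =
    card {w \<in> permutations_of_set (A - F). isolated_maxima w = {}}"
proof -
  have "finite F" using assms finite_subset by blast
  then show ?thesis using assms
  proof (induction F arbitrary: A)
    case (insert v F)
    have "isolated_maxima (insert_max v w) = insert v F \<longleftrightarrow> isolated_maxima w = F"
      if "w \<in> permutations_of_set (A - {v})" for w
    proof -
      have "distinct w" "v \<notin> set w" using that by (auto simp: permutations_of_set_def)
      then show ?thesis
        using insert.hyps(2) isolated_maxima_subset[of w]
        by (subst isolated_maxima_insert_max) (auto dest: insert_ident[THEN iffD1, rotated 2])
    qed
    then have eq: "{w \<in> permutations_of_set (A - {v}). isolated_maxima (insert_max v w) = insert v F}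
      = {w \<in> permutations_of_set (A - {v}). isolated_maxima w = F}" by blast
    have "card {w \<in> permutations_of_set A. isolated_maxima w = insert v F} =
        card {w \<in> permutations_of_set A. v \<in> isolated_maxima w \<and> isolated_maxima w = insert v F}"
      by (rule arg_cong[where f = card]) auto
    also have "\<dots> = card {w \<in> permutations_of_set (A - {v}). isolated_maxima w = F}"
      using bij_betw_same_card[OF bij_betw_insert_max[of v A "\<lambda>w. isolated_maxima w = insert v F"]]
        insert.prems unfolding eq by simp
    also have "\<dots> = card {w \<in> permutations_of_set (A - {v} - F). isolated_maxima w = {}}"
      using insert.prems insert.hyps by (intro insert.IH) auto
    also have "A - {v} - F = A - insert v F" by auto
    finally show ?case .
  qed simp
qed

text \<open>For words of natural numbers it is \<open>hat w\<close>, not \<open>w\<close> read in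
  one-line notation, that has no fixed letter.\<close>

definition derangement_words :: "'a::linorder set \<Rightarrow> 'a list set" where
  "derangement_words A = {w \<in> permutations_of_set A. isolated_maxima w = {}}"

definition derangements_on :: "'a set \<Rightarrow> ('a \<Rightarrow> 'a) set" where
  "derangements_on A = {p. p permutes A \<and> (\<forall>x\<in>A. p x \<noteq> x)}"

text \<open>Words are grouped by their set \<open>F\<close> of isolated maxima, and \<open>B\<close>
  is the complement of \<open>F\<close>. The weight \<open>f\<close> is constantly 1 for the
  recurrence and a binomial coefficient in the final count.\<close>

lemma sum_permutations_isolated_maxima:
  fixes f :: "'a::linorder set \<Rightarrow> nat"
  assumes "finite A"
  shows "(\<Sum>w\<in>permutations_of_set A. f (isolated_maxima w)) =
    (\<Sum>B\<in>Pow A. f (A - B) * card (derangement_words B))"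
proof -
  have "(\<Sum>w\<in>permutations_of_set A. f (isolated_maxima w)) =
    (\<Sum>F\<in>Pow A. \<Sum>w\<in>{w \<in> permutations_of_set A. isolated_maxima w = F}. f (isolated_maxima w))"
    using assms isolated_maxima_subset[where 'a = 'a]
    by (intro sum.group[symmetric]) (auto dest: permutations_of_setD(1))
  also have "\<dots> = (\<Sum>F\<in>Pow A. f F * card (derangement_words (A - F)))"
    using assms by (intro sum.cong)
      (auto simp: derangement_words_def card_isolated_maxima_eq[symmetric])
  also have "\<dots> = (\<Sum>B\<in>Pow A. f (A - B) * card (derangement_words B))"
    by (rule sum.reindex_bij_witness[of _ "\<lambda>B. A - B" "\<lambda>B. A - B"])
      (auto simp: double_diff)
  finally show ?thesis .
qed

lemma sum_card_derangement_words:
  "finite A \<Longrightarrow> (\<Sum>B\<in>Pow A. card (derangement_words B)) = fact (card A)"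
  using sum_permutations_isolated_maxima[of A "\<lambda>_. 1"] by simp

text \<open>Every permutation of \<open>A\<close> is a derangement of exactly one subset, the set of
  its moved points.\<close>

lemma sum_card_derangements_on:
  assumes "finite A"
  shows "(\<Sum>B\<in>Pow A. card (derangements_on B)) = fact (card A)"
proof -
  have eq: "{p. p permutes A} = (\<Union>B\<in>Pow A. derangements_on B)"
  proof safe
    fix p assume p: "p permutes A"
    have "p permutes {x \<in> A. p x \<noteq> x}"
      using p by (rule permutes_superset) auto
    then have "p \<in> derangements_on {x \<in> A. p x \<noteq> x}" by (simp add: derangements_on_def)
    then show "p \<in> (\<Union>B\<in>Pow A. derangements_on B)" by (rule UN_I[rotated]) simp
  next
    fix p B assume "p \<in> derangements_on B" "B \<subseteq> A"
    then show "p permutes A" by (auto simp: derangements_on_def intro: permutes_subset)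
  qed
  have supp: "B = {x. p x \<noteq> x}" if "p \<in> derangements_on B" for p and B :: "'a set"
    using that permutes_not_in[of p B] by (auto simp: derangements_on_def)
  have "card (\<Union>B\<in>Pow A. derangements_on B) = (\<Sum>B\<in>Pow A. card (derangements_on B))"
  proof (rule card_UN_disjoint)
    show "\<forall>B\<in>Pow A. finite (derangements_on B)"
    proof
      fix B assume "B \<in> Pow A"
      then have "finite B" using assms finite_subset by blast
      then have "finite {p. p permutes B}" by (rule finite_permutations)
      then show "finite (derangements_on B)" unfolding derangements_on_def by simp
    qed
    show "\<forall>B\<in>Pow A. \<forall>C\<in>Pow A. B \<noteq> C \<longrightarrow> derangements_on B \<inter> derangements_on C = {}"
      using supp by blast
  qed (use assms in simp)
  then show ?thesis using eq card_permutations[OF refl assms] by simp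
qed

text \<open>By strong induction on the cardinality the terms of all proper subsets agree along a
  bijection, so the remaining top terms agree too. With two element types, words over any linear
  order can be compared with permutations of \<open>{1..j}\<close>.\<close>

lemma eq_if_Pow_sums_eq:
  fixes f :: "'a set \<Rightarrow> nat" and g :: "'b set \<Rightarrow> nat"
  assumes f: "\<And>A. finite A \<Longrightarrow> (\<Sum>B\<in>Pow A. f B) = h (card A)"
    and g: "\<And>A. finite A \<Longrightarrow> (\<Sum>B\<in>Pow A. g B) = h (card A)"
    and "finite A" "finite B" "card A = card B"
  shows "f A = g B"
  using assms(3-)
proof (induction "card A" arbitrary: A B rule: less_induct)
  case less
  obtain \<phi> where \<phi>: "bij_betw \<phi> A B"
    using less.prems finite_same_card_bij by blast
  have "(\<Sum>C\<in>Pow A - {A}. f C) = (\<Sum>C\<in>Pow A - {A}. g (\<phi> ` C))"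
  proof (rule sum.cong[OF refl])
    fix C assume "C \<in> Pow A - {A}"
    then have C: "C \<subset> A" by auto
    then have "card C < card A" "finite C"
      using less.prems(1) psubset_card_mono finite_subset by blast+
    moreover have "card (\<phi> ` C) = card C"
      using C \<phi> by (intro card_image) (auto simp: bij_betw_def intro: inj_on_subset)
    ultimately show "f C = g (\<phi> ` C)" by (intro less.hyps) simp_all
  qed
  also have "\<dots> = (\<Sum>C\<in>Pow B - {B}. g C)"
  proof (rule sum.reindex_bij_betw)
    show "bij_betw ((`) \<phi>) (Pow A - {A}) (Pow B - {B})"
      by (intro bij_betw_DiffI bij_betw_Pow \<phi> bij_betw_singletonI)
        (use \<phi> in \<open>simp_all add: bij_betw_def\<close>)
  qed
  finally have "(\<Sum>C\<in>Pow A - {A}. f C) = (\<Sum>C\<in>Pow B - {B}. g C)" .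
  moreover have "h (card A) = f A + (\<Sum>C\<in>Pow A - {A}. f C)"
    using f[of A] sum.remove[of "Pow A" A f] less.prems by simp
  moreover have "h (card A) = g B + (\<Sum>C\<in>Pow B - {B}. g C)"
    using g[of B] sum.remove[of "Pow B" B g] less.prems by simp
  ultimately show ?case by simp
qed

lemma card_derangement_words:
  assumes "finite A"
  shows "card (derangement_words A) = derangement_number (card A)"
  unfolding derangement_number_def derangements_on_def[symmetric]
  by (rule eq_if_Pow_sums_eq[where h = fact])
    (use assms in \<open>auto simp: sum_card_derangement_words sum_card_derangements_on\<close>)

subsection \<open>Shuffles in which prescribed letters are followed by small ones\<close>

text \<open>In the application \<open>F\<close> consists of the isolated maxima of the subword of
  large letters; a small letter right behind such a letter stops it from being isolated in the full
  word.\<close>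

fun followed_below :: "'a::linorder \<Rightarrow> 'a set \<Rightarrow> 'a list \<Rightarrow> bool" where
  "followed_below m F [] \<longleftrightarrow> True"
| "followed_below m F (x # xs) \<longleftrightarrow> (x \<in> F \<longrightarrow> xs \<noteq> [] \<and> hd xs < m) \<and> followed_below m F xs"

lemma followed_below_iff:
  "followed_below m F w \<longleftrightarrow> (\<forall>u x r. w = u @ x # r \<longrightarrow> x \<in> F \<longrightarrow> r \<noteq> [] \<and> hd r < m)"
proof (induction w)
  case (Cons y w)
  show ?case
    unfolding followed_below.simps Cons
    by (auto simp: Cons_eq_append_conv)
qed simp

lemma followed_below_cong:
  "F \<inter> set w = G \<inter> set w \<Longrightarrow> followed_below m F w = followed_below m G w"
  by (induction w) auto

lemma followed_below_empty [simp]: "followed_below m {} w"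
  by (induction w) auto

text \<open>Gluing each letter of \<open>F\<close> to the small letter behind it leaves
  \<open>length xs + length ys - card F\<close> blocks, and a shuffle is determined by which
  \<open>length ys\<close> of them contain a letter of \<open>ys\<close>. The proof splits by the
  first letter and uses Pascal's rule.\<close>

lemma card_shuffles_followed_below:
  assumes "distinct ys" "F \<subseteq> set ys" "\<forall>x\<in>set xs. x < m" "\<forall>y\<in>set ys. \<not> y < m"
  shows "card {w \<in> shuffles xs ys. followed_below m F w} =
    (length xs + length ys - card F) choose length ys"
  using assms
proof (induction "length xs + length ys" arbitrary: xs ys F rule: less_induct)
  case less
  note prems = less.prems
  have cardF: "card F \<le> length ys"
    using card_mono[OF _ prems(2)] card_length[of ys] by simp
  show ?case
  proof (cases ys)
    case Nil
    then show ?thesis using prems(2) by simp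
  next
    case ys: (Cons y zs)
    show ?thesis
    proof (cases xs)
      case Nil
      show ?thesis
      proof (cases "F = {}")
        case False
        \<comment> \<open>Without small letters a nonempty \<open>F\<close> admits no shuffle; the
          upper entry \<open>length ys - card F\<close> of the binomial is then below
          \<open>length ys\<close>, so the formula also gives 0.\<close>
        then obtain x where x: "x \<in> F" "x \<in> set ys" using prems(2) by auto
        then obtain u r where ur: "ys = u @ x # r" by (auto simp: in_set_conv_decomp)
        then have "r = [] \<or> \<not> hd r < m" using prems(4) by (cases r) auto
        then have "\<not> followed_below m F ys" using ur x unfolding followed_below_iff by blast
        then have "{w \<in> shuffles xs ys. followed_below m F w} = {}" using Nil by auto
        moreover have "card F > 0" "length ys > 0"
          using False finite_subset[OF prems(2)] x by (auto simp: card_gt_0_iff)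
        ultimately show ?thesis using Nil by (simp only: card.empty) (simp add: binomial_eq_0)
      qed (simp add: Nil)
    next
      case xs: (Cons x us)
      let ?S = "{w \<in> shuffles us ys. followed_below m F w}"
      let ?T = "{w \<in> shuffles xs zs. followed_below m F (y # w)}"
      have "x \<notin> F" "x \<noteq> y" using prems xs ys by auto
      then have "{w \<in> shuffles xs ys. followed_below m F w} = (#) x ` ?S \<union> (#) y ` ?T"
        unfolding xs ys by auto
      moreover have "(#) x ` ?S \<inter> (#) y ` ?T = {}" using \<open>x \<noteq> y\<close> by auto
      ultimately have card: "card {w \<in> shuffles xs ys. followed_below m F w} = card ?S + card ?T"
        by (simp add: card_Un_disjoint card_image)
      have S: "card ?S = (length us + length ys - card F) choose length ys"
        using less.hyps[of us ys F] prems xs by simp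
      have T: "card ?T = (length us + length ys - card F) choose length zs"
      proof (cases "y \<in> F")
        case False
        then show ?thesis
          using less.hyps[of xs zs F] prems xs ys by (simp add: subset_insert)
      next
        case True
        have cong: "followed_below m F w \<longleftrightarrow> followed_below m (F - {y}) w" if "y \<notin> set w" for w
          using that by (intro followed_below_cong) auto
        have T_iff: "followed_below m F (y # w) \<longleftrightarrow>
            w \<noteq> [] \<and> hd w < m \<and> followed_below m (F - {y}) w" if "w \<in> shuffles xs zs" for w
        proof -
          have "set w = set xs \<union> set zs" using that by (rule set_shuffles)
          then have "y \<notin> set w" using prems ys by auto
          then show ?thesis using True cong by auto
        qed
        \<comment> \<open>A shuffle starts with \<open>x\<close> or with the head of
          \<open>zs\<close>, and only \<open>x\<close> is below \<open>m\<close>. So a first letter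
          \<open>y\<close> in \<open>F\<close> forces the second letter to be
          \<open>x\<close>.\<close>
        have hd: "w \<in> shuffles xs zs \<and> w \<noteq> [] \<and> hd w < m \<longleftrightarrow> w \<in> (#) x ` shuffles us zs" for w
          using prems(3,4) xs ys by (cases zs) auto
        have "?T = (#) x ` {w \<in> shuffles us zs. followed_below m (F - {y}) w}"
        proof (rule set_eqI)
          fix w
          have "w \<in> ?T \<longleftrightarrow>
              w \<in> shuffles xs zs \<and> w \<noteq> [] \<and> hd w < m \<and> followed_below m (F - {y}) w"
            using T_iff by blast
          also have "\<dots> \<longleftrightarrow> w \<in> (#) x ` shuffles us zs \<and> followed_below m (F - {y}) w"
            using hd by blast
          also have "\<dots> \<longleftrightarrow> w \<in> (#) x ` {w \<in> shuffles us zs. followed_below m (F - {y}) w}"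
            using \<open>x \<notin> F\<close> by auto
          finally show "w \<in> ?T \<longleftrightarrow>
              w \<in> (#) x ` {w \<in> shuffles us zs. followed_below m (F - {y}) w}" .
        qed
        then have "card ?T = card {w \<in> shuffles us zs. followed_below m (F - {y}) w}"
          by (simp add: card_image)
        also have "\<dots> = (length us + length zs - card (F - {y})) choose length zs"
          using less.hyps[of us zs "F - {y}"] prems xs ys by auto
        \<comment> \<open>Both \<open>zs\<close> and \<open>F - {y}\<close> have lost one element,
          so the difference is unchanged.\<close>
        also have "length us + length zs - card (F - {y}) = length us + length ys - card F"
          using True ys finite_subset[OF prems(2)] card_Suc_Diff1[of F y] by auto
        finally show ?thesis .
      qed
      \<comment> \<open>By \<open>cardF\<close> the subtraction is not truncated, so
        \<open>S\<close> and \<open>T\<close> are the two summands of Pascal's rule.\<close>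
      have "length xs + length ys - card F = Suc (length us + length ys - card F)"
        using cardF xs by simp
      then show ?thesis unfolding card S T using ys by simp
    qed
  qed
qed

subsection \<open>Words avoiding the pattern\<close>

lemma sorted_wrt_filter_iff:
  "sorted_wrt R (filter P w) \<longleftrightarrow>
    (\<forall>i j. i < j \<longrightarrow> j < length w \<longrightarrow> P (w ! i) \<longrightarrow> P (w ! j) \<longrightarrow> R (w ! i) (w ! j))"
proof (induction w)
  case (Cons x w)
  have "(\<forall>y\<in>set (filter P w). R x y) \<longleftrightarrow> (\<forall>j<length w. P (w ! j) \<longrightarrow> R x (w ! j))"
    by (auto simp: in_set_conv_nth)
  then show ?case
    using Cons by (auto simp: All_less_Suc2 nth_Cons split: nat.splits)
qed simp

text \<open>The arrow makes \<open>x 3\<close> a letter fixed by \<open>hat w\<close>, that is, an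
  isolated maximum, and the word \<open>12\<close> asks for an ascending pair among the letters
  below it, wherever they stand relative to it.\<close>

lemma contains_12_33_iff:
  assumes w: "w \<in> permutations_of_set {1..n}"
  shows "contains_arrow_pattern w ([1, 2], {(3, 3)}) \<longleftrightarrow>
    (\<exists>v\<in>isolated_maxima w. \<not> sorted_wrt (>) (filter (\<lambda>x. x < v) w))"
proof -
  have dist: "distinct w" and set: "set w = {1..n}" and len: "length w = n"
    using w length_finite_permutations_of_set[OF w] by (auto simp: permutations_of_set_def)
  have supp: "card (pattern_support ([1, 2], {(3, 3)})) = 3" by simp
  show ?thesis
  proof
    assume "contains_arrow_pattern w ([1, 2], {(3, 3)})"
    then obtain x t :: "nat \<Rightarrow> nat" where x: "strict_mono_on {1..3} x" "x ` {1..3} \<subseteq> {1..length w}"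
      and t: "strict_mono_on {..<2} t" "t ` {..<2} \<subseteq> {..<length w}"
      and eq: "\<forall>i<2. w ! t i = x ([1, 2] ! i)" and hat: "hat w (x 3) = x 3"
      unfolding contains_arrow_pattern.simps supp by (auto simp: numeral_2_eq_2)
    have lt: "x 1 < x 2" "x 2 < x 3" "t 0 < t 1" "t 1 < length w"
      using strict_mono_onD[OF x(1), of 1 2] strict_mono_onD[OF x(1), of 2 3]
        strict_mono_onD[OF t(1), of 0 1] t(2) by (auto simp: image_subset_iff)
    have "x 3 \<in> {1..n}" using x(2) len by force
    then have "x 3 \<in> isolated_maxima w" using hat hat_fixed_iff[OF dist] set by simp
    moreover have "w ! t 0 = x 1" "w ! t 1 = x 2" using eq by auto
    then have "\<not> sorted_wrt (>) (filter (\<lambda>y. y < x 3) w)"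
      using lt unfolding sorted_wrt_filter_iff by fastforce
    ultimately show "\<exists>v\<in>isolated_maxima w. \<not> sorted_wrt (>) (filter (\<lambda>x. x < v) w)" by blast
  next
    assume "\<exists>v\<in>isolated_maxima w. \<not> sorted_wrt (>) (filter (\<lambda>x. x < v) w)"
    then obtain v i j where v: "v \<in> isolated_maxima w" and ij: "i < j" "j < length w"
      "w ! i < v" "w ! j < v" "\<not> w ! i > w ! j"
      unfolding sorted_wrt_filter_iff by blast
    have vw: "v \<in> set w" using v isolated_maxima_subset by blast
    have "w ! i \<noteq> w ! j" using ij dist by (simp add: nth_eq_iff_index_eq)
    then have lt: "w ! i < w ! j" using ij by simp
    have in_set: "w ! i \<in> set w" "w ! j \<in> set w" using ij by auto
    \<comment> \<open>The pattern letters are numbered from 1 and the positions from 0; values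
      outside \<open>{1..3}\<close> and \<open>{..<2}\<close> are arbitrary defaults.\<close>
    define x where "x k = (if k = 1 then w ! i else if k = 2 then w ! j else v)" for k :: nat
    define t where "t k = (if k = 0 then i else j)" for k :: nat
    have "strict_mono_on {1..3} x"
      using lt ij by (intro strict_mono_onI) (auto simp: x_def)
    moreover have "x ` {1..3} \<subseteq> {1..length w}"
      using in_set vw unfolding set len by (simp add: x_def image_subset_iff)
    moreover have "strict_mono_on {..<2} t"
      using ij by (intro strict_mono_onI) (auto simp: t_def)
    moreover have "t ` {..<2} \<subseteq> {..<length w}" using ij by (auto simp: t_def)
    moreover have "\<forall>k<2. w ! t k = x ([1, 2] ! k)"
      by (auto simp: x_def t_def less_2_cases_iff)
    moreover have "hat w (x 3) = x 3"
      using hat_fixed_iff[OF dist vw] v by (simp add: x_def)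
    ultimately show "contains_arrow_pattern w ([1, 2], {(3, 3)})"
      unfolding contains_arrow_pattern.simps supp by (auto simp: numeral_2_eq_2)
  qed
qed

section \<open>Classification of the avoiders by their largest isolated maximum\<close>

definition max_isolated_words :: "nat \<Rightarrow> nat \<Rightarrow> nat list set" where
  "max_isolated_words n m = {w \<in> permutations_of_set {1..n}. m \<in> isolated_maxima w \<and>
     (\<forall>v\<in>isolated_maxima w. v \<le> m) \<and> sorted_wrt (>) (filter (\<lambda>x. x < m) w)}"

lemma sorted_wrt_filter_mono:
  "sorted_wrt R (filter P w) \<Longrightarrow> (\<And>x. Q x \<Longrightarrow> P x) \<Longrightarrow> sorted_wrt R (filter Q w)"
  unfolding sorted_wrt_filter_iff by blast

text \<open>Without isolated maxima avoidance is vacuous. Otherwise the largest one decides, since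
  the letters below a smaller one form a subsequence of the letters below the largest.\<close>

lemma avoiders_12_33:
  "avoiders n ([1, 2], {(3, 3)}) = derangement_words {1..n} \<union> (\<Union>m\<in>{1..n}. max_isolated_words n m)"
proof (rule set_eqI)
  fix w
  show "w \<in> avoiders n ([1, 2], {(3, 3)}) \<longleftrightarrow>
    w \<in> derangement_words {1..n} \<union> (\<Union>m\<in>{1..n}. max_isolated_words n m)"
  proof (cases "w \<in> permutations_of_set {1..n}")
    case True
    let ?F = "isolated_maxima w"
    have F: "?F \<subseteq> {1..n}"
      using isolated_maxima_subset[of w] True by (simp add: permutations_of_set_def)
    have av: "w \<in> avoiders n ([1, 2], {(3, 3)}) \<longleftrightarrow>
        (\<forall>v\<in>?F. sorted_wrt (>) (filter (\<lambda>x. x < v) w))"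
      unfolding avoiders_def mem_Collect_eq contains_12_33_iff[OF True] using True by blast
    show ?thesis
    proof (cases "?F = {}")
      case F0: True
      then show ?thesis using av True by (simp add: derangement_words_def)
    next
      case False
      have fin: "finite ?F" using F finite_subset by blast
      have Max: "Max ?F \<in> ?F" "\<forall>v\<in>?F. v \<le> Max ?F" using fin False by auto
      have "w \<notin> derangement_words {1..n}" using False by (simp add: derangement_words_def)
      moreover have "w \<in> (\<Union>m\<in>{1..n}. max_isolated_words n m) \<longleftrightarrow>
          sorted_wrt (>) (filter (\<lambda>x. x < Max ?F) w)"
        using Max F True unfolding max_isolated_words_def
        by (auto dest: order_antisym)
      moreover have "(\<forall>v\<in>?F. sorted_wrt (>) (filter (\<lambda>x. x < v) w)) \<longleftrightarrow>
          sorted_wrt (>) (filter (\<lambda>x. x < Max ?F) w)"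
      proof
        assume sorted: "sorted_wrt (>) (filter (\<lambda>x. x < Max ?F) w)"
        show "\<forall>v\<in>?F. sorted_wrt (>) (filter (\<lambda>x. x < v) w)"
        proof
          fix v assume "v \<in> ?F"
          then show "sorted_wrt (>) (filter (\<lambda>x. x < v) w)"
            using Max(2) by (intro sorted_wrt_filter_mono[OF sorted]) (auto dest: order_less_le_trans)
        qed
      qed (use Max(1) in blast)
      ultimately show ?thesis using av by simp
    qed
  qed (auto simp: avoiders_def derangement_words_def max_isolated_words_def)
qed

text \<open>Letters below \<open>m\<close> cannot prevent a larger letter from being a left-to-right
  maximum. They matter only as its immediate successor, where they destroy isolation.\<close>

lemma isolated_maxima_filter_iff:
  assumes "distinct w" "m \<notin> set w"
  shows "(\<forall>v\<in>isolated_maxima w. v < m) \<longleftrightarrow>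
    followed_below m (isolated_maxima (filter (\<lambda>x. \<not> x < m) w)) w"
proof -
  let ?f = "filter (\<lambda>x. \<not> x < m)"
  have key: "b \<in> isolated_maxima w \<longleftrightarrow>
      b \<in> isolated_maxima (?f w) \<and> \<not> (r \<noteq> [] \<and> hd r < m)"
    if w: "w = u @ b # r" and b: "\<not> b < m" for u b r
  proof -
    have fw: "?f w = ?f u @ b # ?f r" using w b by simp
    have 1: "b \<in> isolated_maxima w \<longleftrightarrow> (\<forall>x\<in>set u. x < b) \<and> (r = [] \<or> b < hd r)"
      using isolated_maxima_iff assms(1) unfolding w by blast
    have 2: "b \<in> isolated_maxima (?f w) \<longleftrightarrow>
        (\<forall>x\<in>set (?f u). x < b) \<and> (?f r = [] \<or> b < hd (?f r))"
      using isolated_maxima_iff[of "?f u" b "?f r"] distinct_filter[OF assms(1), of "\<lambda>x. \<not> x < m"]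
      unfolding fw by blast
    have "(\<forall>x\<in>set (?f u). x < b) \<longleftrightarrow> (\<forall>x\<in>set u. x < b)"
      using b by auto
    \<comment> \<open>If \<open>hd r\<close> is not below \<open>m\<close>, it survives the filter
      and is the successor of \<open>b\<close> in both words.\<close>
    then show ?thesis unfolding 1 2 using b by (cases r) auto
  qed
  have "(\<forall>v\<in>isolated_maxima w. v < m) \<longleftrightarrow>
      (\<forall>u b r. w = u @ b # r \<longrightarrow> b \<in> isolated_maxima w \<longrightarrow> b < m)"
    using isolated_maxima_subset[of w] by (metis split_list subsetD)
  also have "\<dots> \<longleftrightarrow> (\<forall>u b r. w = u @ b # r \<longrightarrow> b \<in> isolated_maxima (?f w) \<longrightarrow> r \<noteq> [] \<and> hd r < m)"
    using key isolated_maxima_subset[of "?f w"] by (smt (verit) mem_Collect_eq set_filter subsetD)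
  finally show ?thesis unfolding followed_below_iff .
qed

lemma decreasing_list_eq:
  assumes "sorted_wrt (>) xs" "set xs = {1..<m}"
  shows "xs = rev [1..<m]"
proof -
  have "sorted_wrt (<) (rev xs)" using assms(1) by (simp add: sorted_wrt_rev)
  then have "rev xs = [1..<m]" using assms(2) by (intro strict_sorted_equal) auto
  then show ?thesis by (metis rev_rev_ident)
qed

lemma filter_shuffles_part:
  assumes "w \<in> shuffles xs ys" "\<forall>x\<in>set xs. P x" "\<forall>y\<in>set ys. \<not> P y"
  shows "filter P w = xs" "filter (\<lambda>x. \<not> P x) w = ys"
proof -
  have "partition P w = (xs, ys)"
    using inv_image_partition[of xs P ys] assms by blast
  then show "filter P w = xs" "filter (\<lambda>x. \<not> P x) w = ys"
    by (simp_all add: o_def)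
qed

text \<open>After deletion of \<open>m\<close> the words are classified by the subword
  \<open>\<sigma>\<close> of letters above \<open>m\<close>; the number of shuffles depends on
  \<open>\<sigma>\<close> only through its number of isolated maxima.\<close>

lemma card_max_isolated_words:
  assumes "m \<in> {1..n}"
  shows "card (max_isolated_words n m) =
    (\<Sum>k=0..n-m. ((n - m) choose k) * ((m + k - 1) choose (n - m)) * derangement_number k)"
proof -
  let ?B = "{m<..n}" and ?\<tau> = "rev [1..<m]"
  let ?P = "\<lambda>w. (\<forall>v\<in>isolated_maxima w. v \<le> m) \<and> sorted_wrt (>) (filter (\<lambda>x. x < m) w)"
  let ?W = "\<lambda>\<sigma>. {w \<in> shuffles ?\<tau> \<sigma>. followed_below m (isolated_maxima \<sigma>) w}"
  have "card (max_isolated_words n m) =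
      card {w \<in> permutations_of_set ({1..n} - {m}). ?P (insert_max m w)}"
    unfolding max_isolated_words_def
    using bij_betw_same_card[OF bij_betw_insert_max[OF assms, of ?P]] by simp
  also have "{w \<in> permutations_of_set ({1..n} - {m}). ?P (insert_max m w)} =
      (\<Union>\<sigma>\<in>permutations_of_set ?B. ?W \<sigma>)"
  proof (rule set_eqI, rule iffI)
    fix w assume "w \<in> {w \<in> permutations_of_set ({1..n} - {m}). ?P (insert_max m w)}"
    then have w: "set w = {1..n} - {m}" "distinct w" and P: "?P (insert_max m w)"
      by (auto simp: permutations_of_set_def)
    let ?\<sigma> = "filter (\<lambda>x. \<not> x < m) w"
    \<comment> \<open>Putting \<open>m\<close> back adds only \<open>m\<close> to the isolated
      maxima, so the bound \<open>\<le> m\<close> there is the strict bound for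
      \<open>w\<close>.\<close>
    have "\<forall>v\<in>isolated_maxima w. v < m"
      using P w isolated_maxima_insert_max[of w m] isolated_maxima_subset[of w]
      by (auto simp: order_less_le)
    then have "followed_below m (isolated_maxima ?\<sigma>) w"
      using isolated_maxima_filter_iff w by blast
    moreover have "filter (\<lambda>x. x < m) w = ?\<tau>"
      using P w assms by (intro decreasing_list_eq) (auto simp: filter_insert_max)
    then have "w \<in> shuffles ?\<tau> ?\<sigma>" using partition_in_shuffles[of w "\<lambda>x. x < m"] by simp
    moreover have "set ?\<sigma> = ?B" unfolding set_filter w(1) using assms by (auto simp: not_less)
    then have "?\<sigma> \<in> permutations_of_set ?B" using w(2) by (intro permutations_of_setI) simp_all
    ultimately show "w \<in> (\<Union>\<sigma>\<in>permutations_of_set ?B. ?W \<sigma>)" by blast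
  next
    fix w assume "w \<in> (\<Union>\<sigma>\<in>permutations_of_set ?B. ?W \<sigma>)"
    then obtain \<sigma> where \<sigma>: "set \<sigma> = ?B" "distinct \<sigma>" and w: "w \<in> shuffles ?\<tau> \<sigma>"
      "followed_below m (isolated_maxima \<sigma>) w"
      by (auto simp: permutations_of_set_def)
    have part: "filter (\<lambda>x. x < m) w = ?\<tau>" "filter (\<lambda>x. \<not> x < m) w = \<sigma>"
      using filter_shuffles_part[OF w(1), of "\<lambda>x. x < m"] \<sigma>(1) by auto
    have set: "set w = {1..n} - {m}" using set_shuffles[OF w(1)] \<sigma>(1) assms by auto
    have dist: "distinct w"
      by (rule distinct_disjoint_shuffles[OF _ \<sigma>(2) _ w(1)]) (use \<sigma>(1) in auto)
    have "\<forall>v\<in>isolated_maxima w. v < m"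
      using isolated_maxima_filter_iff[OF dist] set part(2) w(2) by simp
    then have "?P (insert_max m w)"
      using set dist part(1) isolated_maxima_insert_max[of w m]
      by (auto simp: filter_insert_max sorted_wrt_rev)
    then show "w \<in> {w \<in> permutations_of_set ({1..n} - {m}). ?P (insert_max m w)}"
      using set dist by (simp add: permutations_of_set_def)
  qed
  also have "card \<dots> = (\<Sum>\<sigma>\<in>permutations_of_set ?B. card (?W \<sigma>))"
  proof (rule card_UN_disjoint)
    \<comment> \<open>The word determines \<open>\<sigma>\<close> as its subword of letters not
      below \<open>m\<close>, so the classes are disjoint.\<close>
    have filter: "filter (\<lambda>x. \<not> x < m) w = \<sigma>"
      if "\<sigma> \<in> permutations_of_set ?B" "w \<in> ?W \<sigma>" for w \<sigma>
      using filter_shuffles_part[of w ?\<tau> \<sigma> "\<lambda>x. x < m"] that by (auto dest: permutations_of_setD)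
    show "\<forall>\<sigma>\<in>permutations_of_set ?B. \<forall>\<rho>\<in>permutations_of_set ?B. \<sigma> \<noteq> \<rho> \<longrightarrow> ?W \<sigma> \<inter> ?W \<rho> = {}"
      using filter by blast
  qed auto
  \<comment> \<open>The lengths \<open>m - 1\<close> of \<open>?\<tau>\<close> and
    \<open>n - m\<close> of \<open>\<sigma>\<close> add up to \<open>n - 1\<close>.\<close>
  also have "\<dots> = (\<Sum>\<sigma>\<in>permutations_of_set ?B. (n - 1 - card (isolated_maxima \<sigma>)) choose (n - m))"
  proof (rule sum.cong[OF refl])
    fix \<sigma> assume s: "\<sigma> \<in> permutations_of_set ?B"
    then have "length \<sigma> = n - m" by (simp add: length_finite_permutations_of_set)
    then show "card (?W \<sigma>) = (n - 1 - card (isolated_maxima \<sigma>)) choose (n - m)"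
      using card_shuffles_followed_below[of \<sigma> "isolated_maxima \<sigma>" ?\<tau> m] s assms
        isolated_maxima_subset[of \<sigma>]
      by (auto simp: permutations_of_set_def)
  qed
  \<comment> \<open>\<open>C\<close> is the set of letters of \<open>\<sigma>\<close> that are not
    isolated maxima; its cardinality becomes the index \<open>k\<close> of the formula.\<close>
  also have "\<dots> = (\<Sum>C\<in>Pow ?B. ((n - 1 - card (?B - C)) choose (n - m)) * card (derangement_words C))"
    by (rule sum_permutations_isolated_maxima) simp
  also have "\<dots> = (\<Sum>C\<in>Pow ?B. ((m + card C - 1) choose (n - m)) * derangement_number (card C))"
  proof (rule sum.cong[OF refl])
    fix C assume C: "C \<in> Pow ?B"
    then have fin: "finite C" by (auto intro: finite_subset)
    have "card C \<le> n - m" using C card_mono[of ?B C] by auto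
    moreover have "card (?B - C) = n - m - card C" using C fin by (simp add: card_Diff_subset)
    ultimately have "n - 1 - card (?B - C) = m + card C - 1" using assms by auto
    then show "((n - 1 - card (?B - C)) choose (n - m)) * card (derangement_words C) =
        ((m + card C - 1) choose (n - m)) * derangement_number (card C)"
      using fin by (simp add: card_derangement_words)
  qed
  also have "\<dots> = (\<Sum>k\<in>{0..n-m}. \<Sum>C\<in>{C \<in> Pow ?B. card C = k}.
      ((m + card C - 1) choose (n - m)) * derangement_number (card C))"
    using card_mono[of ?B] by (intro sum.group[symmetric]) auto
  also have "\<dots> = (\<Sum>k=0..n-m. ((n - m) choose k) * ((m + k - 1) choose (n - m)) * derangement_number k)"
    using n_subsets[of ?B] by (intro sum.cong) (auto simp: Pow_def)
  finally show ?thesis .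
qed

theorem theorem3p1:
  fixes n :: nat
  assumes "n \<ge> 1"
  shows "card (avoiders n ([1, 2], {(3, 3)})) =
    derangement_number n +
    (\<Sum>m=1..n. \<Sum>k=0..n-m.
       ((n - m) choose k) * ((m + k - 1) choose (n - m)) * derangement_number k)"
proof -
  let ?U = "\<Union>m\<in>{1..n}. max_isolated_words n m"
  have fin: "finite (derangement_words {1..n})" "finite (max_isolated_words n m)" for m
    by (auto simp: derangement_words_def max_isolated_words_def)
  have "card (avoiders n ([1, 2], {(3, 3)})) = card (derangement_words {1..n}) + card ?U"
    unfolding avoiders_12_33 using fin
    by (intro card_Un_disjoint) (auto simp: derangement_words_def max_isolated_words_def)
  also have "card ?U = (\<Sum>m=1..n. card (max_isolated_words n m))"
    \<comment> \<open>Disjointness holds because \<open>m\<close> is the largest isolated maximum of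
      every word in its class.\<close>
    using fin by (intro card_UN_disjoint) (auto simp: max_isolated_words_def dest: order_antisym)
  finally show ?thesis
    by (simp add: card_derangement_words card_max_isolated_words)
qed

end
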